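(* Let $F$ be a field of characteristic different from $2$, $D$ a diagonalizable algebraic group over $F$ with character group $X$, and let $g\in X$, $x\in Lie(D)$ be such that $g^2=1$ whenever $x\neq 0$. Let $h_1,\ldots,h_s\in X$ and let $V$ be a finite-dimensional $D_{g,x}$-supermodule with $V^*\simeq L(h_1)\oplus\cdots\oplus L(h_s)$. Then a (super)polynomial $f=\sum_{l,J}a_{l,J}f_0^lf_1^J\in F[V]$ (with $a_{l,J}\in F$, almost all zero) belongs to $F[V]^{D_{g,x}}$ if and only if the following two conditions are satisfied: (1) if $a_{l,J}\neq 0$, then $h^lh^Jg^{|J|}=1$; (2) the polynomial \[\sum_{l, J}a_{l, J}\Big(\sum_{j\notin J}(-1)^{k_{j, J\cup \{j\}}}l_j\, x(h_j)f_0^{l-\epsilon_j}f_1^{J\cup \{j\}}+\sum_{j\in J}(-1)^{k_{j, J}} f_0^{l+\epsilon_j}f_1^{J\setminus \{j\}}\Big)\] vanishes.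
   Context: $F[D]=FX$ is the group algebra of $X$, and $Lie(D)$ is identified with the space of linear maps $y:FX\to F$ with $y(g_1g_2)=y(g_1)+y(g_2)$ for $g_1,g_2\in X$. The supergroup $D_{g,x}$ is the affine supergroup with coordinate Hopf superalgebra $F[D_{g,x}]=FX\oplus(FX)z$, where $FX$ is even, $z$ is odd, $z^2=0$, and \[\Delta(h)=h\otimes h+x(h)\,hz\otimes hgz,\quad \Delta(z)=1\otimes z+z\otimes g,\quad \epsilon(h)=1,\ \epsilon(z)=0,\quad s(h)=h^{-1},\ s(z)=-g^{-1}z\] for $h\in X$. Tensor products of superalgebras have multiplication $(a\otimes b)(c\otimes d)=(-1)^{|b||c|}ac\otimes bd$. A $D_{g,x}$-supermodule is a right $F[D_{g,x}]$-supercomodule. For $h\in X$, $L(h)=Fh\oplus Fhz\subseteq F[D_{g,x}]$ is a supersubmodule (coaction given by $\Delta$). For $V$ with $V^*\simeq L(h_1)\oplus\cdots\oplus L(h_s)$, $F[V]$ is the free supercommutative superalgebra on $V^*$, i.e. generated by even elements $f_{j,0}$ and odd (anticommuting, square-zero) elements $f_{j,1}$, $1\leq j\leq s$ (corresponding to $h_j$ and $h_jz$ in $L(h_j)$), and its coaction is the superalgebra homomorphism $\tau:F[V]\to F[V]\otimes F[D_{g,x}]$ with \[\tau(f_{j,0})=f_{j,0}\otimes h_j+x(h_j)f_{j,1}\otimes h_jgz,\qquad \tau(f_{j,1})=f_{j,0}\otimes h_jz+f_{j,1}\otimes h_jg.\] $F[V]^{D_{g,x}}=\{f\in F[V]\mid\tau(f)=f\otimes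 1\}$. Notation: $l=(l_1,\ldots,l_s)$ runs over vectors of non-negative integers, $J$ over subsets of $\{1,\ldots,s\}$; $f_0^l=\prod_jf_{j,0}^{l_j}$, $f_1^J=\prod_{j\in J}f_{j,1}$ (factors in increasing order of $j$), $h^l=\prod_jh_j^{l_j}$, $h^J=\prod_{j\in J}h_j$; $\epsilon_j$ is the $j$-th standard unit vector; $k_{j,J}$ is the number of $j'\in J$ with $j'>j$. Terms with $l_j=0$ in the first inner sum are zero. *)

theory Defs
  imports
    "HOL-Library.Poly_Mapping"
    "HOL-Algebra.FiniteProduct"
    "HOL-Algebra.Generated_Groups"
    "HOL-Computational_Algebra.Computational_Algebra"
begin

section \<open>Superspaces with a homogeneous basis\<close>

text \<open>
  A superspace is given by a homogeneous basis: an index set and a parity (\<open>True\<close> meaning odd).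
  Its vectors are the finitely supported families of scalars on the index set, so \<open>V \<otimes> W\<close> is the
  superspace on the product of the index sets.
\<close>

record 'b superspace =
  Idx :: "'b set"
  Par :: "'b \<Rightarrow> bool"

abbreviation bvec :: "'b \<Rightarrow> ('b \<Rightarrow>\<^sub>0 'k::field)" where
  "bvec b \<equiv> Poly_Mapping.single b 1"

definition vecs :: "('b, 'm) superspace_scheme \<Rightarrow> ('b \<Rightarrow>\<^sub>0 'k::field) set" where
  "vecs S = {u. Poly_Mapping.keys u \<subseteq> Idx S}"

definition scl :: "'k::field \<Rightarrow> ('b \<Rightarrow>\<^sub>0 'k) \<Rightarrow> ('b \<Rightarrow>\<^sub>0 'k)" where
  "scl c u = Poly_Mapping.map ((*) c) u"

text \<open>The linear extension of a map given on basis vectors.\<close>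

definition lin :: "('b \<Rightarrow> ('c \<Rightarrow>\<^sub>0 'k::field)) \<Rightarrow> ('b \<Rightarrow>\<^sub>0 'k) \<Rightarrow> ('c \<Rightarrow>\<^sub>0 'k)" where
  "lin T u = (\<Sum>b\<in>Poly_Mapping.keys u. scl (Poly_Mapping.lookup u b) (T b))"

definition linear_between ::
  "('b, 'm) superspace_scheme \<Rightarrow> ('c, 'n) superspace_scheme
    \<Rightarrow> (('b \<Rightarrow>\<^sub>0 'k::field) \<Rightarrow> ('c \<Rightarrow>\<^sub>0 'k)) \<Rightarrow> bool" where
  "linear_between S T \<phi> \<longleftrightarrow>
     (\<forall>u\<in>vecs S. \<phi> u \<in> vecs T) \<and>
     (\<forall>u\<in>vecs S. \<forall>v\<in>vecs S. \<phi> (u + v) = \<phi> u + \<phi> v) \<and>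
     (\<forall>c. \<forall>u\<in>vecs S. \<phi> (scl c u) = scl c (\<phi> u))"

definition even_linear ::
  "('b, 'm) superspace_scheme \<Rightarrow> ('c, 'n) superspace_scheme
    \<Rightarrow> (('b \<Rightarrow>\<^sub>0 'k::field) \<Rightarrow> ('c \<Rightarrow>\<^sub>0 'k)) \<Rightarrow> bool" where
  "even_linear S T \<phi> \<longleftrightarrow> linear_between S T \<phi> \<and>
     (\<forall>b\<in>Idx S. \<forall>c\<in>Poly_Mapping.keys (\<phi> (bvec b)). Par T c = Par S b)"

definition tensor_space ::
  "('b, 'm) superspace_scheme \<Rightarrow> ('c, 'n) superspace_scheme \<Rightarrow> ('b \<times> 'c) superspace" where
  "tensor_space S T = \<lparr>Idx = Idx S \<times> Idx T, Par = (\<lambda>(b, c). Par S b \<noteq> Par T c)\<rparr>"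

definition tens :: "('b \<Rightarrow>\<^sub>0 'k::field) \<Rightarrow> ('c \<Rightarrow>\<^sub>0 'k) \<Rightarrow> ('b \<times> 'c \<Rightarrow>\<^sub>0 'k)" where
  "tens u v = lin (\<lambda>b. lin (\<lambda>c. bvec (b, c)) v) u"

text \<open>The map \<open>\<phi> \<otimes> \<psi>\<close>; it is used for even maps only, so no sign occurs.\<close>

definition tens_map ::
  "(('b \<Rightarrow>\<^sub>0 'k::field) \<Rightarrow> ('b' \<Rightarrow>\<^sub>0 'k)) \<Rightarrow> (('c \<Rightarrow>\<^sub>0 'k) \<Rightarrow> ('c' \<Rightarrow>\<^sub>0 'k))
    \<Rightarrow> ('b \<times> 'c \<Rightarrow>\<^sub>0 'k) \<Rightarrow> ('b' \<times> 'c' \<Rightarrow>\<^sub>0 'k)" where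
  "tens_map \<phi> \<psi> = lin (\<lambda>(b, c). tens (\<phi> (bvec b)) (\<psi> (bvec c)))"

section \<open>Superalgebras\<close>

record (overloaded) ('b, 'k) superalgebra = "'b superspace" +
  BMul :: "'b \<Rightarrow> 'b \<Rightarrow> ('b \<Rightarrow>\<^sub>0 'k)"  \<comment> \<open>products of basis vectors\<close>
  One :: "'b \<Rightarrow>\<^sub>0 'k"

definition amul :: "('b, 'k::field) superalgebra \<Rightarrow> ('b \<Rightarrow>\<^sub>0 'k) \<Rightarrow> ('b \<Rightarrow>\<^sub>0 'k) \<Rightarrow> ('b \<Rightarrow>\<^sub>0 'k)" where
  "amul A u v = lin (\<lambda>b. lin (\<lambda>c. BMul A b c) v) u"

definition aprod :: "('b, 'k::field) superalgebra \<Rightarrow> ('b \<Rightarrow>\<^sub>0 'k) list \<Rightarrow> ('b \<Rightarrow>\<^sub>0 'k)" where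
  "aprod A us = foldr (amul A) us (One A)"

definition tensor_algebra ::
  "('b, 'k::field) superalgebra \<Rightarrow> ('c, 'k) superalgebra \<Rightarrow> ('b \<times> 'c, 'k) superalgebra" where
  "tensor_algebra A B =
     \<lparr>Idx = Idx (tensor_space A B), Par = Par (tensor_space A B),
      BMul = (\<lambda>(a, b) (c, d). scl (if Par B b \<and> Par A c then -1 else 1) (tens (BMul A a c) (BMul B b d))),
      One = tens (One A) (One B)\<rparr>"

definition superalgebra_hom ::
  "('b, 'k::field) superalgebra \<Rightarrow> ('c, 'k) superalgebra \<Rightarrow> (('b \<Rightarrow>\<^sub>0 'k) \<Rightarrow> ('c \<Rightarrow>\<^sub>0 'k)) \<Rightarrow> bool" where
  "superalgebra_hom A B \<phi> \<longleftrightarrow> even_linear A B \<phi> \<and> \<phi> (One A) = One B \<and>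
     (\<forall>u\<in>vecs A. \<forall>v\<in>vecs A. \<phi> (amul A u v) = amul B (\<phi> u) (\<phi> v))"

section \<open>Right supercomodules\<close>

record (overloaded) ('b, 'c, 'k) supercomodule = "'b superspace" +
  Coact :: "('b \<Rightarrow>\<^sub>0 'k) \<Rightarrow> ('b \<times> 'c \<Rightarrow>\<^sub>0 'k)"

text \<open>
  Right supercomodules over a supercoalgebra \<open>C\<close> with comultiplication \<open>\<Delta>\<close> and counit \<open>\<epsilon>\<close>.
  The coassociativity equation compares elements of \<open>(W \<otimes> C) \<otimes> C\<close> and \<open>W \<otimes> (C \<otimes> C)\<close>.
\<close>

definition is_supercomodule ::
  "('c, 'm) superspace_scheme \<Rightarrow> (('c \<Rightarrow>\<^sub>0 'k::field) \<Rightarrow> ('c \<times> 'c \<Rightarrow>\<^sub>0 'k)) \<Rightarrow> (('c \<Rightarrow>\<^sub>0 'k) \<Rightarrow> 'k)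
    \<Rightarrow> ('b, 'c, 'k) supercomodule \<Rightarrow> bool" where
  "is_supercomodule C \<Delta> \<epsilon> W \<longleftrightarrow> even_linear W (tensor_space W C) (Coact W) \<and>
     (\<forall>w\<in>vecs W.
        (\<forall>b c d. Poly_Mapping.lookup (tens_map (Coact W) (\<lambda>u. u) (Coact W w)) ((b, c), d) =
                 Poly_Mapping.lookup (tens_map (\<lambda>u. u) \<Delta> (Coact W w)) (b, (c, d))) \<and>
        lin (\<lambda>(b, c). scl (\<epsilon> (bvec c)) (bvec b)) (Coact W w) = w)"

definition supercomodule_iso ::
  "('b, 'c, 'k::field) supercomodule \<Rightarrow> ('d, 'c, 'k) supercomodule \<Rightarrow> (('b \<Rightarrow>\<^sub>0 'k) \<Rightarrow> ('d \<Rightarrow>\<^sub>0 'k)) \<Rightarrow> bool" where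
  "supercomodule_iso V W \<phi> \<longleftrightarrow> even_linear V W \<phi> \<and> bij_betw \<phi> (vecs V) (vecs W) \<and>
     (\<forall>v\<in>vecs V. Coact W (\<phi> v) = tens_map \<phi> (\<lambda>u. u) (Coact V v))"

definition direct_sum :: "'i set \<Rightarrow> ('i \<Rightarrow> ('b, 'c, 'k::field) supercomodule) \<Rightarrow> ('i \<times> 'b, 'c, 'k) supercomodule" where
  "direct_sum I W =
     \<lparr>Idx = (SIGMA i:I. Idx (W i)), Par = (\<lambda>(i, b). Par (W i) b),
      Coact = lin (\<lambda>(i, b). tens_map (lin (\<lambda>b'. bvec (i, b'))) (\<lambda>u. u) (Coact (W i) (bvec b)))\<rparr>"

text \<open>
  The coefficients of \<open>V\<close> are the \<open>t b d\<close> with \<open>Coact V (bvec d) = (\<Sum>b. bvec b \<otimes> t b d)\<close>.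
  The dual of a finite-dimensional \<open>V\<close> is written in the dual basis \<open>v\<^sup>b\<close>, with
  \<open>v\<^sup>b \<mapsto> (\<Sum>d. (-1) ^ ((|b| + |d|) |d|) v\<^sup>d \<otimes> s (t b d))\<close>, \<open>s\<close> being the antipode; the signs are those for which
  the evaluation \<open>V\<^sup>* \<otimes> V \<rightarrow> F\<close> is a morphism of supercomodules.
\<close>

definition mcoeff :: "('b, 'c, 'k::field) supercomodule \<Rightarrow> 'b \<Rightarrow> 'b \<Rightarrow> ('c \<Rightarrow>\<^sub>0 'k)" where
  "mcoeff V b d = lin (\<lambda>(b', c). if b' = b then bvec c else 0) (Coact V (bvec d))"

definition dual :: "(('c \<Rightarrow>\<^sub>0 'k::field) \<Rightarrow> ('c \<Rightarrow>\<^sub>0 'k)) \<Rightarrow> ('b, 'c, 'k) supercomodule \<Rightarrow> ('b, 'c, 'k) supercomodule" where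
  "dual s V =
     \<lparr>Idx = Idx V, Par = Par V,
      Coact = lin (\<lambda>b. \<Sum>d\<in>Idx V. scl (if Par V b \<noteq> Par V d \<and> Par V d then -1 else 1)
                                    (tens (bvec d) (s (mcoeff V b d))))\<rparr>"

section \<open>Diagonalizable groups\<close>

text \<open>
  A diagonalizable algebraic group \<open>D\<close> is given by its character group, an arbitrary finitely
  generated abelian group \<open>X\<close>; \<open>F[D]\<close> is the group algebra of \<open>X\<close>.
\<close>

definition diagonalizable_char_group :: "('x, 'm) monoid_scheme \<Rightarrow> bool" where
  "diagonalizable_char_group X \<longleftrightarrow> comm_group X \<and> (\<exists>S. finite S \<and> S \<subseteq> carrier X \<and> generate X S = carrier X)"

definition FX :: "('x, 'm) monoid_scheme \<Rightarrow> ('x \<Rightarrow>\<^sub>0 'k::field) set" where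
  "FX X = {u. Poly_Mapping.keys u \<subseteq> carrier X}"

definition Lie :: "('x, 'm) monoid_scheme \<Rightarrow> (('x \<Rightarrow>\<^sub>0 'k::field) \<Rightarrow> 'k) set" where
  "Lie X = {y. (\<forall>u\<in>FX X. \<forall>v\<in>FX X. y (u + v) = y u + y v) \<and>
               (\<forall>c. \<forall>u\<in>FX X. y (scl c u) = c * y u) \<and>
               (\<forall>h\<in>carrier X. \<forall>h'\<in>carrier X. y (bvec (h \<otimes>\<^bsub>X\<^esub> h')) = y (bvec h) + y (bvec h'))}"

section \<open>The supergroup \<open>D\<^sub>g\<^sub>,\<^sub>x\<close>\<close>

text \<open>
  The basis of \<open>F[D\<^sub>g\<^sub>,\<^sub>x] = FX \<oplus> (FX)z\<close> is indexed by pairs: \<open>(h, False)\<close> stands for \<open>h\<close> and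
  \<open>(h, True)\<close> for \<open>hz\<close>.
\<close>

definition D_alg :: "('x, 'm) monoid_scheme \<Rightarrow> ('x \<times> bool, 'k::field) superalgebra" where
  "D_alg X =
     \<lparr>Idx = carrier X \<times> UNIV, Par = snd,
      BMul = (\<lambda>(h, i) (h', i'). if i \<and> i' then 0 else bvec (h \<otimes>\<^bsub>X\<^esub> h', i \<or> i')),
      One = bvec (\<one>\<^bsub>X\<^esub>, False)\<rparr>"

text \<open>\<open>\<Delta>(hz)\<close> is \<open>\<Delta>(h) \<Delta>(z)\<close> in \<open>F[D\<^sub>g\<^sub>,\<^sub>x] \<otimes> F[D\<^sub>g\<^sub>,\<^sub>x]\<close>, and \<open>s(hz) = s(h) s(z)\<close>.\<close>

definition D_comult_grp ::
  "('x, 'm) monoid_scheme \<Rightarrow> 'x \<Rightarrow> (('x \<Rightarrow>\<^sub>0 'k::field) \<Rightarrow> 'k) \<Rightarrow> 'x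
    \<Rightarrow> (('x \<times> bool) \<times> ('x \<times> bool) \<Rightarrow>\<^sub>0 'k)" where
  "D_comult_grp X g x h =
     tens (bvec (h, False)) (bvec (h, False)) +
     scl (x (bvec h)) (tens (bvec (h, True)) (bvec (h \<otimes>\<^bsub>X\<^esub> g, True)))"

definition D_comult_z ::
  "('x, 'm) monoid_scheme \<Rightarrow> 'x \<Rightarrow> (('x \<times> bool) \<times> ('x \<times> bool) \<Rightarrow>\<^sub>0 'k::field)" where
  "D_comult_z X g =
     tens (bvec (\<one>\<^bsub>X\<^esub>, False)) (bvec (\<one>\<^bsub>X\<^esub>, True)) + tens (bvec (\<one>\<^bsub>X\<^esub>, True)) (bvec (g, False))"

definition D_comult ::
  "('x, 'm) monoid_scheme \<Rightarrow> 'x \<Rightarrow> (('x \<Rightarrow>\<^sub>0 'k::field) \<Rightarrow> 'k)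
    \<Rightarrow> ('x \<times> bool \<Rightarrow>\<^sub>0 'k) \<Rightarrow> (('x \<times> bool) \<times> ('x \<times> bool) \<Rightarrow>\<^sub>0 'k)" where
  "D_comult X g x = lin (\<lambda>(h, i).
     if i then amul (tensor_algebra (D_alg X) (D_alg X)) (D_comult_grp X g x h) (D_comult_z X g)
     else D_comult_grp X g x h)"

definition D_counit :: "('x \<times> bool \<Rightarrow>\<^sub>0 'k::field) \<Rightarrow> 'k" where
  "D_counit u = (\<Sum>(h, i)\<in>Poly_Mapping.keys u. if i then 0 else Poly_Mapping.lookup u (h, i))"

definition D_antipode :: "('x, 'm) monoid_scheme \<Rightarrow> 'x \<Rightarrow> ('x \<times> bool \<Rightarrow>\<^sub>0 'k::field) \<Rightarrow> ('x \<times> bool \<Rightarrow>\<^sub>0 'k)" where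
  "D_antipode X g = lin (\<lambda>(h, i).
     if i then amul (D_alg X) (bvec (inv\<^bsub>X\<^esub> h, False)) (- bvec (inv\<^bsub>X\<^esub> g, True))
     else bvec (inv\<^bsub>X\<^esub> h, False))"

definition D_supermodule ::
  "('x, 'm) monoid_scheme \<Rightarrow> 'x \<Rightarrow> (('x \<Rightarrow>\<^sub>0 'k::field) \<Rightarrow> 'k) \<Rightarrow> ('b, 'x \<times> bool, 'k) supercomodule \<Rightarrow> bool" where
  "D_supermodule X g x V \<longleftrightarrow>
     is_supercomodule (D_alg X :: ('x \<times> bool, 'k) superalgebra) (D_comult X g x) D_counit V"

definition L :: "('x, 'm) monoid_scheme \<Rightarrow> 'x \<Rightarrow> (('x \<Rightarrow>\<^sub>0 'k::field) \<Rightarrow> 'k) \<Rightarrow> 'x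
    \<Rightarrow> ('x \<times> bool, 'x \<times> bool, 'k) supercomodule" where
  "L X g x h = \<lparr>Idx = {h} \<times> UNIV, Par = snd, Coact = D_comult X g x\<rparr>"

text \<open>The external direct sum of the \<open>L(h j)\<close>, \<open>1 \<le> j \<le> s\<close>; its basis consists of the \<open>(j, (h j, i))\<close>.\<close>

definition L_sum :: "('x, 'm) monoid_scheme \<Rightarrow> 'x \<Rightarrow> (('x \<Rightarrow>\<^sub>0 'k::field) \<Rightarrow> 'k) \<Rightarrow> nat \<Rightarrow> (nat \<Rightarrow> 'x)
    \<Rightarrow> (nat \<times> ('x \<times> bool), 'x \<times> bool, 'k) supercomodule" where
  "L_sum X g x s h = direct_sum {1..s} (\<lambda>j. L X g x (h j))"

section \<open>The superalgebra \<open>F[V]\<close>\<close>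

text \<open>
  The free supercommutative superalgebra on even generators \<open>fgen0 j\<close> and odd generators \<open>fgen1 j\<close>,
  \<open>1 \<le> j \<le> s\<close>. Its basis vector with index \<open>(l, J)\<close> is the monomial \<open>f\<^sub>0\<^sup>l f\<^sub>1\<^sup>J\<close>, factors in increasing
  order; the sign in a product counts the transpositions needed to sort \<open>f\<^sub>1\<^sup>J f\<^sub>1\<^sup>J\<^sup>'\<close>.
\<close>

type_synonym mono_idx = "(nat \<Rightarrow> nat) \<times> nat set"

definition mono_idxs :: "nat \<Rightarrow> mono_idx set" where
  "mono_idxs s = {(l, J). (\<forall>j. j \<notin> {1..s} \<longrightarrow> l j = 0) \<and> J \<subseteq> {1..s}}"

definition FV :: "nat \<Rightarrow> (mono_idx, 'k::field) superalgebra" where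
  "FV s =
     \<lparr>Idx = mono_idxs s, Par = (\<lambda>(l, J). odd (card J)),
      BMul = (\<lambda>(l, J) (l', J'). if J \<inter> J' \<noteq> {} then 0
        else Poly_Mapping.single (\<lambda>j. l j + l' j, J \<union> J') ((-1) ^ card {(i, j) \<in> J \<times> J'. j < i})),
      One = bvec (\<lambda>_. 0, {})\<rparr>"

definition fgen0 :: "nat \<Rightarrow> (mono_idx \<Rightarrow>\<^sub>0 'k::field)" where
  "fgen0 j = bvec ((\<lambda>_. 0)(j := 1), {})"

definition fgen1 :: "nat \<Rightarrow> (mono_idx \<Rightarrow>\<^sub>0 'k::field)" where
  "fgen1 j = bvec (\<lambda>_. 0, {j})"

definition fpow0 :: "nat \<Rightarrow> (nat \<Rightarrow> nat) \<Rightarrow> (mono_idx \<Rightarrow>\<^sub>0 'k::field)" where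
  "fpow0 s l = aprod (FV s) (concat (map (\<lambda>j. replicate (l j) (fgen0 j)) [1..<Suc s]))"

definition fpow1 :: "nat \<Rightarrow> nat set \<Rightarrow> (mono_idx \<Rightarrow>\<^sub>0 'k::field)" where
  "fpow1 s J = aprod (FV s) (map fgen1 (sorted_list_of_set J))"

definition fmono :: "nat \<Rightarrow> (nat \<Rightarrow> nat) \<Rightarrow> nat set \<Rightarrow> (mono_idx \<Rightarrow>\<^sub>0 'k::field)" where
  "fmono s l J = amul (FV s) (fpow0 s l) (fpow1 s J)"

text \<open>The embedding of the direct sum of the \<open>L(h j)\<close> as the space of generators:
  \<open>h j \<mapsto> fgen0 j\<close> and \<open>h j z \<mapsto> fgen1 j\<close>.\<close>

definition gens :: "(nat \<times> ('x \<times> bool) \<Rightarrow>\<^sub>0 'k::field) \<Rightarrow> (mono_idx \<Rightarrow>\<^sub>0 'k)" where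
  "gens = lin (\<lambda>(j, (u, i)). if i then fgen1 j else fgen0 j)"

text \<open>
  Given an isomorphism \<open>\<phi>\<close> of \<open>W = V\<^sup>*\<close> onto the direct sum of the \<open>L(h j)\<close>, the space \<open>W\<close> is
  identified with the span of the generators of \<open>F[V]\<close> through \<open>gens \<circ> \<phi>\<close>; the coaction on
  \<open>F[V]\<close> is the superalgebra homomorphism extending that of \<open>W\<close>.
\<close>

definition is_coaction ::
  "('x, 'm) monoid_scheme \<Rightarrow> nat \<Rightarrow> ('b, 'x \<times> bool, 'k::field) supercomodule
    \<Rightarrow> (('b \<Rightarrow>\<^sub>0 'k) \<Rightarrow> (nat \<times> ('x \<times> bool) \<Rightarrow>\<^sub>0 'k))
    \<Rightarrow> ((mono_idx \<Rightarrow>\<^sub>0 'k) \<Rightarrow> (mono_idx \<times> ('x \<times> bool) \<Rightarrow>\<^sub>0 'k)) \<Rightarrow> bool" where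
  "is_coaction X s W \<phi> \<tau> \<longleftrightarrow>
     superalgebra_hom (FV s) (tensor_algebra (FV s) (D_alg X)) \<tau> \<and>
     (\<forall>w\<in>vecs W. \<tau> (gens (\<phi> w)) = tens_map (gens \<circ> \<phi>) (\<lambda>u. u) (Coact W w))"

definition invariants ::
  "('x, 'm) monoid_scheme \<Rightarrow> nat \<Rightarrow> ((mono_idx \<Rightarrow>\<^sub>0 'k::field) \<Rightarrow> (mono_idx \<times> ('x \<times> bool) \<Rightarrow>\<^sub>0 'k))
    \<Rightarrow> (mono_idx \<Rightarrow>\<^sub>0 'k) set" where
  "invariants X s \<tau> = {f \<in> vecs (FV s :: (mono_idx, 'k) superalgebra). \<tau> f = tens f (One (D_alg X))}"

definition kidx :: "nat \<Rightarrow> nat set \<Rightarrow> nat" where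
  "kidx j J = card {j' \<in> J. j < j'}"

section \<open>Consistency checks\<close>

lemma lookup_scl [simp]: "Poly_Mapping.lookup (scl c u) b = c * Poly_Mapping.lookup u b"
  unfolding scl_def by (simp add: Poly_Mapping.map.rep_eq when_def)

lemma scl_simps [simp]: "scl 0 u = 0" "scl c 0 = 0" "scl 1 u = u"
  by (rule poly_mapping_eqI, simp)+

lemma scl_add_left: "scl (c + d) u = scl c u + scl d u"
  by (rule poly_mapping_eqI) (simp add: lookup_add algebra_simps)

lemma scl_add_right: "scl c (u + v) = scl c u + scl c v"
  by (rule poly_mapping_eqI) (simp add: lookup_add algebra_simps)

lemma scl_scl: "scl c (scl d u) = scl (c * d) u"
  by (rule poly_mapping_eqI) (simp add: mult.assoc)

lemma scl_sum: "scl c (\<Sum>i\<in>I. f i) = (\<Sum>i\<in>I. scl c (f i))"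
  by (induction I rule: infinite_finite_induct) (simp_all add: scl_add_right)

lemma lin_superset:
  assumes "finite B" "Poly_Mapping.keys u \<subseteq> B"
  shows "lin T u = (\<Sum>b\<in>B. scl (Poly_Mapping.lookup u b) (T b))"
  unfolding lin_def using assms
  by (intro sum.mono_neutral_left) (auto simp: in_keys_iff)

lemma lin_0 [simp]: "lin T 0 = 0"
  by (simp add: lin_def)

lemma lin_single: "lin T (Poly_Mapping.single b c) = scl c (T b)"
  by (subst lin_superset[of "{b}"]) auto

lemma lin_bvec [simp]: "lin T (bvec b) = T b"
  by (simp add: lin_single)

lemma lin_add: "lin T (u + v) = lin T u + lin T v"
proof -
  let ?B = "Poly_Mapping.keys u \<union> Poly_Mapping.keys v"
  have "Poly_Mapping.keys (u + v) \<subseteq> ?B" by (rule Poly_Mapping.keys_add)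
  then show ?thesis
    by (simp add: lin_superset[of ?B] lookup_add scl_add_left sum.distrib)
qed

lemma lin_scl: "lin T (scl c u) = scl c (lin T u)"
proof -
  have "Poly_Mapping.keys (scl c u) \<subseteq> Poly_Mapping.keys u"
    by (auto simp: in_keys_iff)
  then show ?thesis
    by (simp add: lin_superset[of "Poly_Mapping.keys u"] scl_sum scl_scl)
qed

lemma tens_bvec [simp]: "tens (bvec b) (bvec c) = bvec (b, c)"
  by (simp add: tens_def)

lemma D_comult_h:
  "D_comult X g x (bvec (h, False)) =
     tens (bvec (h, False)) (bvec (h, False)) + scl (x (bvec h)) (tens (bvec (h, True)) (bvec (h \<otimes>\<^bsub>X\<^esub> g, True)))"
  by (simp add: D_comult_def D_comult_grp_def)

lemma D_comult_hz:
  assumes "comm_group X" "g \<in> carrier X" "h \<in> carrier X"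
  shows "D_comult X g x (bvec (h, True)) =
     tens (bvec (h, False)) (bvec (h, True)) + tens (bvec (h, True)) (bvec (h \<otimes>\<^bsub>X\<^esub> g, False))"
proof -
  interpret comm_group X by fact
  show ?thesis
    using assms(2,3)
    by (simp add: D_comult_def D_comult_grp_def D_comult_z_def amul_def lin_add lin_scl
        tensor_algebra_def D_alg_def tens_def lin_single scl_add_right)
qed

lemma coact_fgen0:
  "tens_map gens (\<lambda>u. u) (Coact (L_sum X g x s h) (bvec (j, (h j, False)))) =
     tens (fgen0 j) (bvec (h j, False)) +
     scl (x (bvec (h j))) (tens (fgen1 j) (bvec (h j \<otimes>\<^bsub>X\<^esub> g, True)))"
  by (simp add: L_sum_def direct_sum_def L_def D_comult_h tens_map_def lin_add lin_scl gens_def)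

lemma coact_fgen1:
  assumes "comm_group X" "g \<in> carrier X" "h j \<in> carrier X"
  shows "tens_map gens (\<lambda>u. u) (Coact (L_sum X g x s h) (bvec (j, (h j, True)))) =
     tens (fgen0 j) (bvec (h j, True)) + tens (fgen1 j) (bvec (h j \<otimes>\<^bsub>X\<^esub> g, False))"
  using assms
  by (simp add: L_sum_def direct_sum_def L_def D_comult_hz tens_map_def lin_add lin_scl gens_def)

lemma amul_FV_bvec:
  "amul (FV s) (bvec (l, J)) (bvec (l', J')) =
     (if J \<inter> J' \<noteq> {} then 0
      else Poly_Mapping.single (\<lambda>j. l j + l' j, J \<union> J') ((-1) ^ card {(i, j) \<in> J \<times> J'. j < i}))"
  by (simp add: amul_def FV_def)

lemma fpow0_eq:
  assumes "\<And>j. j \<notin> {1..s} \<Longrightarrow> l j = 0"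
  shows "fpow0 s l = (bvec (l, {}) :: mono_idx \<Rightarrow>\<^sub>0 'k::field)"
proof -
  have "aprod (FV s) (map (\<lambda>j. fgen0 j) js) = (bvec (\<lambda>j. count_list js j, {}) :: mono_idx \<Rightarrow>\<^sub>0 'k)"
    for js :: "nat list"
  proof (induction js)
    case Nil
    then show ?case by (simp add: aprod_def FV_def)
  next
    case (Cons i js)
    then show ?case
      by (auto simp: aprod_def fgen0_def amul_FV_bvec fun_eq_iff intro!: arg_cong[where f = "\<lambda>i. bvec (i, {})"])
  qed
  note * = this[of "concat (map (\<lambda>j. replicate (l j) j) [1..<Suc s])"]
  have cr: "count_list (replicate n i) j = (if i = j then n else 0)" for n i j :: nat
    by (induction n) auto
  have "count_list (concat (map (\<lambda>j. replicate (l j) j) js)) j = (if j \<in> set js then l j else 0)"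
    if "distinct js" for js j
    using that by (induction js) (auto simp: cr count_list_append)
  from this[of "[1..<Suc s]"]
  have "count_list (concat (map (\<lambda>j. replicate (l j) j) [1..<Suc s])) = l"
    using assms by (fastforce simp: fun_eq_iff)
  with * show ?thesis
    by (simp add: fpow0_def map_concat comp_def)
qed

lemma fpow1_eq:
  assumes "finite J"
  shows "fpow1 s J = (bvec (\<lambda>_. 0, J) :: mono_idx \<Rightarrow>\<^sub>0 'k::field)"
proof -
  have "aprod (FV s) (map fgen1 js) = (bvec (\<lambda>_. 0, set js) :: mono_idx \<Rightarrow>\<^sub>0 'k)"
    if "sorted js" "distinct js" for js :: "nat list"
    using that
  proof (induction js)
    case Nil
    then show ?case by (simp add: aprod_def FV_def)
  next
    case (Cons i js)
    have "{(i', j). i' = i \<and> j \<in> set js \<and> j < i'} = {}"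
      using Cons.prems by auto
    then have "card {(i', j). i' = i \<and> j \<in> set js \<and> j < i'} = 0"
      by (simp only: card.empty)
    with Cons show ?case
      by (simp add: aprod_def fgen1_def amul_FV_bvec del: card_eq_0_iff)
  qed
  from this[of "sorted_list_of_set J"] assms show ?thesis
    by (simp add: fpow1_def)
qed

lemma fmono_eq:
  assumes "(l, J) \<in> mono_idxs s"
  shows "fmono s l J = (bvec (l, J) :: mono_idx \<Rightarrow>\<^sub>0 'k::field)"
proof -
  have l: "l j = 0" if "j \<notin> {1..s}" for j
    using that assms by (auto simp: mono_idxs_def)
  have "finite J"
    using assms by (auto simp: mono_idxs_def intro: finite_subset)
  then have "fpow1 s J = (bvec (\<lambda>_. 0, J) :: mono_idx \<Rightarrow>\<^sub>0 'k)"
    by (rule fpow1_eq)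
  moreover have "fpow0 s l = (bvec (l, {}) :: mono_idx \<Rightarrow>\<^sub>0 'k)"
    by (rule fpow0_eq) (rule l)
  ultimately show ?thesis
    by (simp add: fmono_def amul_FV_bvec)
qed

end

theory Submission
  imports Defs
begin

text \<open>
  On a monomial \<open>m\<close> of weight \<open>w\<close> the coaction is \<open>\<tau>(m) = m \<otimes> w + d(m) \<otimes> w g\<^sup>-\<^sup>1 z\<close>, where \<open>d(m)\<close> is the
  summand of condition (2) belonging to \<open>m\<close>: since \<open>z\<^sup>2 = 0\<close>, at most one factor of \<open>m\<close> contributes a \<open>z\<close>, and
  the signs come from moving that \<open>z\<close> to the right past the odd factors. The summands with a
  factor \<open>x(h\<^sub>j)\<close> carry \<open>w g z\<close> instead of \<open>w g\<^sup>-\<^sup>1 z\<close>; this is where \<open>g\<^sup>2 = 1\<close> is needed. Comparing the two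
  components of \<open>\<tau>(f) = f \<otimes> 1\<close> gives the two conditions.
\<close>

section \<open>Linear extensions and tensor products\<close>

lemma lin_sum: "lin T (\<Sum>i\<in>I. f i) = (\<Sum>i\<in>I. lin T (f i))"
  by (induction I rule: infinite_finite_induct) (simp_all add: lin_add)

lemma lin_lin: "lin S (lin T u) = lin (\<lambda>b. lin S (T b)) u"
proof -
  have "lin S (lin T u) = (\<Sum>b\<in>Poly_Mapping.keys u. scl (Poly_Mapping.lookup u b) (lin S (T b)))"
    by (simp add: lin_def[of T u] lin_sum lin_scl)
  then show ?thesis
    by (simp add: lin_def[of _ u])
qed

lemma lin_zero_fun [simp]: "lin (\<lambda>_. 0) u = 0"
  by (simp add: lin_def)

lemma lookup_sum: "Poly_Mapping.lookup (\<Sum>i\<in>I. f i) b = (\<Sum>i\<in>I. Poly_Mapping.lookup (f i) b)"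
  by (induction I rule: infinite_finite_induct) (simp_all add: lookup_add)

lemma lookup_tens_bvec:
  "Poly_Mapping.lookup (tens u (bvec c)) (b, d) = (if d = c then Poly_Mapping.lookup u b else 0)"
  by (simp add: tens_def lin_def[of _ u] lookup_sum lookup_single when_def in_keys_iff if_distrib cong: if_cong)

lemma tens_lin: "tens (lin T u) w = lin (\<lambda>b. tens (T b) w) u"
  by (simp add: tens_def lin_lin)

lemma tens_add_left: "tens (u + v) w = tens u w + tens v w"
  by (simp add: tens_def lin_add)

lemma tens_scl_left: "tens (scl c u) w = scl c (tens u w)"
  by (simp add: tens_def lin_scl)

lemma tens_sum_left: "tens (\<Sum>i\<in>I. f i) w = (\<Sum>i\<in>I. tens (f i) w)"
  by (simp add: tens_def lin_sum)

lemma tens_0_left [simp]: "tens 0 w = 0"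
  by (simp add: tens_def)

text \<open>\<open>tens_map\<close> only looks at values on basis vectors, so composition needs
  linearity of the outer map alone; it is therefore taken of the form \<open>lin T\<close>, as
  \<open>gens\<close> is. This serves to split the map \<open>gens \<circ> \<phi>\<close> in
  \<open>is_coaction\<close>.\<close>

lemma tens_map_tens_map_id:
  "tens_map (lin T) (\<lambda>u. u) (tens_map \<phi> (\<lambda>u. u) u) = tens_map (lin T \<circ> \<phi>) (\<lambda>u. u) u"
proof -
  have *: "lin (\<lambda>(b, c). tens (lin T (bvec b)) (bvec c)) (tens v (bvec c)) = tens (lin T v) (bvec c)" for v c
    by (simp add: tens_def[of v] lin_lin tens_lin)
  have "(\<lambda>p. lin (\<lambda>(b, c). tens (lin T (bvec b)) (bvec c)) (case p of (b, c) \<Rightarrow> tens (\<phi> (bvec b)) (bvec c))) =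
      (\<lambda>(b, c). tens ((lin T \<circ> \<phi>) (bvec b)) (bvec c))"
    by (rule ext) (simp only: split_paired_all prod.case * comp_def)
  then show ?thesis
    unfolding tens_map_def lin_lin by (rule arg_cong[where f = "\<lambda>T. lin T u"])
qed

section \<open>Products in a superalgebra and in its tensor product with the coordinate
  algebra\<close>

lemma amul_bvec: "amul A (bvec a) v = lin (BMul A a) v"
  by (simp add: amul_def)

lemma amul_add_left: "amul A (u + v) w = amul A u w + amul A v w"
  by (simp add: amul_def lin_add)

lemma amul_scl_left: "amul A (scl c u) w = scl c (amul A u w)"
  by (simp add: amul_def lin_scl)

lemma amul_bvec_add: "amul A (bvec a) (v + w) = amul A (bvec a) v + amul A (bvec a) w"
  by (simp add: amul_bvec lin_add)

lemma amul_bvec_scl: "amul A (bvec a) (scl c v) = scl c (amul A (bvec a) v)"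
  by (simp add: amul_bvec lin_scl)

lemma amul_bvec_sum: "amul A (bvec a) (\<Sum>i\<in>I. f i) = (\<Sum>i\<in>I. amul A (bvec a) (f i))"
  by (simp add: amul_bvec lin_sum)

lemma tensor_mul_even:
  "amul (tensor_algebra A (D_alg X)) (bvec (a, (u, False))) (tens v (bvec (u', i))) =
     tens (amul A (bvec a) v) (bvec (u \<otimes>\<^bsub>X\<^esub> u', i))"
  by (simp add: amul_bvec tens_def[of v] lin_lin tens_lin tensor_algebra_def D_alg_def)

lemma tensor_mul_odd_even:
  "amul (tensor_algebra A (D_alg X)) (bvec (a, (u, True))) (bvec (b, (u', False))) =
     scl (if Par A b then -1 else 1) (tens (amul A (bvec a) (bvec b)) (bvec (u \<otimes>\<^bsub>X\<^esub> u', True)))"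
  by (simp add: amul_bvec tensor_algebra_def D_alg_def)

lemma tens_0_right [simp]: "tens u 0 = 0"
  by (simp add: tens_def lin_def)

text \<open>This is \<open>z^2 = 0\<close> in the second tensor factor; it removes the only
  quadratic term in products of coaction values.\<close>

lemma tensor_mul_odd_odd:
  "amul (tensor_algebra A (D_alg X)) (bvec (a, (u, True))) (tens v (bvec (u', True))) = 0"
  by (simp add: amul_bvec tens_def[of v] lin_lin tensor_algebra_def D_alg_def lin_zero_fun)

section \<open>Vectors of a superspace and linear maps on them\<close>

lemma vecs_add: "u \<in> vecs S \<Longrightarrow> v \<in> vecs S \<Longrightarrow> u + v \<in> vecs S"
  unfolding vecs_def mem_Collect_eq by (rule order_trans[OF Poly_Mapping.keys_add Un_least])

lemma vecs_scl: "u \<in> vecs S \<Longrightarrow> scl c u \<in> vecs S"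
  by (auto simp: vecs_def in_keys_iff)

lemma vecs_bvec: "b \<in> Idx S \<Longrightarrow> bvec b \<in> vecs S"
  by (simp add: vecs_def)

lemma vecs_0: "0 \<in> vecs S"
  by (simp add: vecs_def)

lemma vecs_sum: "(\<And>i. i \<in> I \<Longrightarrow> f i \<in> vecs S) \<Longrightarrow> (\<Sum>i\<in>I. f i) \<in> vecs S"
  by (induction I rule: infinite_finite_induct) (simp_all add: vecs_0 vecs_add)

lemma linear_between_sum:
  assumes "linear_between S T \<phi>" "\<And>i. i \<in> I \<Longrightarrow> f i \<in> vecs S"
  shows "\<phi> (\<Sum>i\<in>I. scl (c i) (f i)) = (\<Sum>i\<in>I. scl (c i) (\<phi> (f i)))"
proof -
  have add: "\<phi> (u + v) = \<phi> u + \<phi> v" if "u \<in> vecs S" "v \<in> vecs S" for u v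
    using assms(1) that by (simp add: linear_between_def)
  have scl: "\<phi> (scl c u) = scl c (\<phi> u)" if "u \<in> vecs S" for c u
    using assms(1) that by (simp add: linear_between_def)
  have 0: "\<phi> 0 = 0"
    using scl[OF vecs_0, of 0] by simp
  from assms(2) show ?thesis
  proof (induction I rule: infinite_finite_induct)
    case (insert i I)
    have "(\<Sum>i\<in>I. scl (c i) (f i)) \<in> vecs S" "scl (c i) (f i) \<in> vecs S" "f i \<in> vecs S"
      using insert.prems by (auto intro!: vecs_sum vecs_scl)
    then show ?case
      using insert by (simp add: add scl)
  qed (simp_all add: 0)
qed

section \<open>The odd derivation\<close>

text \<open>The odd derivation acting from the right with \<open>f_{j,0} |-> c_j f_{j,1}\<close> and
  \<open>f_{j,1} |-> f_{j,0}\<close>: the sign counts the odd factors standing to the right of the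
  one concerned. For \<open>l j = 0\<close> the truncated exponent \<open>l j - 1\<close> is
  harmless, because the factor \<open>of_nat (l j)\<close> kills the summand.\<close>

definition odd_der :: "nat \<Rightarrow> (nat \<Rightarrow> 'k::field) \<Rightarrow> mono_idx \<Rightarrow> (mono_idx \<Rightarrow>\<^sub>0 'k)" where
  "odd_der s c = (\<lambda>(l, J).
     (\<Sum>j \<in> {1..s} - J. scl ((-1) ^ kidx j (J \<union> {j}) * of_nat (l j) * c j)
        (bvec (l(j := l j - 1), J \<union> {j}))) +
     (\<Sum>j \<in> J. scl ((-1) ^ kidx j J) (bvec (l(j := l j + 1), J - {j}))))"

lemma fgen0_mul: "amul (FV s) (fgen0 j) (bvec (l, J)) = bvec (l(j := l j + 1), J)"
  by (auto simp: fgen0_def amul_FV_bvec fun_eq_iff intro!: arg_cong[where f = "\<lambda>l. bvec (l, J)"])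

lemma fgen1_mul:
  assumes "j \<notin> J"
  shows "amul (FV s) (fgen1 j) (bvec (l, J)) = scl ((-1) ^ card {i \<in> J. i < j}) (bvec (l, insert j J))"
proof -
  have "{(i, i') \<in> {j} \<times> J. i' < i} = Pair j ` {i \<in> J. i < j}"
    by auto
  then have "card {(i, i') \<in> {j} \<times> J. i' < i} = card {i \<in> J. i < j}"
    by (simp add: card_image inj_on_def)
  then have "amul (FV s) (fgen1 j) (bvec (l, J)) =
      Poly_Mapping.single (l, insert j J) ((-1) ^ card {i \<in> J. i < j})"
    using assms by (simp add: fgen1_def amul_FV_bvec)
  also have "\<dots> = scl ((-1) ^ card {i \<in> J. i < j}) (bvec (l, insert j J))"
    by (rule poly_mapping_eqI) (simp add: lookup_single when_def)
  finally show ?thesis .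
qed

lemma fgen1_mul_less:
  assumes "\<And>i. i \<in> J \<Longrightarrow> j < i"
  shows "amul (FV s) (fgen1 j) (bvec (l, J)) = bvec (l, insert j J)"
proof -
  have "{i \<in> J. i < j} = {}"
    using assms by fastforce
  then have card0: "card {i \<in> J. i < j} = 0"
    by (simp only: card.empty)
  have "j \<notin> J"
    using assms by blast
  then show ?thesis
    by (subst fgen1_mul) (simp_all only: card0 power_0 scl_simps not_False_eq_True)
qed

lemma fgen1_mul_0: "j \<in> J \<Longrightarrow> amul (FV s) (fgen1 j) (bvec (l, J)) = 0"
  by (simp add: fgen1_def amul_FV_bvec)

text \<open>The elements of \<open>J\<close> lie either above or below \<open>j\<close>, and the
  sign for those below occurs twice. This converts the sign of condition (2), which counts larger
  indices, into the sign from sorting a new factor \<open>f_{j,1}\<close> placed in front, which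
  counts smaller ones.\<close>

lemma kidx_sign:
  assumes "finite J" "j \<notin> J"
  shows "(-1) ^ kidx j (J \<union> {j}) = (-1 :: 'k::field) ^ card J * (-1) ^ card {i \<in> J. i < j}"
proof -
  let ?m = "card {i \<in> J. i < j}"
  have "card ({i \<in> J. j < i} \<union> {i \<in> J. i < j}) = card {i \<in> J. j < i} + ?m"
    using assms(1) by (intro card_Un_disjoint) auto
  moreover have "{i \<in> J. j < i} \<union> {i \<in> J. i < j} = J"
    using assms(2) nat_neq_iff by blast
  moreover have "{i \<in> J \<union> {j}. j < i} = {i \<in> J. j < i}"
    by auto
  ultimately have "card J = kidx j (J \<union> {j}) + ?m"
    by (simp add: kidx_def)
  moreover have "(-1 :: 'k) ^ ?m * (-1) ^ ?m = 1"
    by (simp flip: power_mult_distrib)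
  ultimately show ?thesis
    by (simp only: power_add mult.assoc mult_1_right)
qed

text \<open>The Leibniz rule of a right odd derivation for an even left factor. The extra term comes
  from \<open>of_nat (l j + 1) = of_nat (l j) + 1\<close> in the summand of
  \<open>j\<close>.\<close>

lemma odd_der_fgen0_mul:
  assumes "j \<in> {1..s}" "J \<subseteq> {1..s}"
  shows "odd_der s c (l(j := l j + 1), J) =
     amul (FV s) (fgen0 j) (odd_der s c (l, J)) +
     scl ((-1) ^ card J * c j) (amul (FV s) (fgen1 j) (bvec (l, J)))"
proof -
  let ?l = "l(j := l j + 1)"
  let ?e = "scl ((-1) ^ card J * c j) (amul (FV s) (fgen1 j) (bvec (l, J)))"
  have fin: "finite J"
    using assms(2) finite_subset by blast
  have mul0: "amul (FV s) (fgen0 j) (u + v) = amul (FV s) (fgen0 j) u + amul (FV s) (fgen0 j) v"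
    "amul (FV s) (fgen0 j) (scl b u) = scl b (amul (FV s) (fgen0 j) u)"
    "amul (FV s) (fgen0 j) (\<Sum>i\<in>I. f i) = (\<Sum>i\<in>I. amul (FV s) (fgen0 j) (f i))"
    for u v :: "mono_idx \<Rightarrow>\<^sub>0 'a" and b and I :: "nat set" and f
    by (simp_all add: fgen0_def amul_bvec_add amul_bvec_scl amul_bvec_sum)
  have 1: "scl ((-1) ^ kidx i (J \<union> {i}) * of_nat (?l i) * c i) (bvec (?l(i := ?l i - 1), J \<union> {i})) =
      scl ((-1) ^ kidx i (J \<union> {i}) * of_nat (l i) * c i)
        (amul (FV s) (fgen0 j) (bvec (l(i := l i - 1), J \<union> {i}))) + (if i = j then ?e else 0)"
    if i: "i \<in> {1..s} - J" for i
  proof (cases "i = j")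
    case True
    \<comment> \<open>Lowering and then raising the exponent of \<open>j\<close> restores
      \<open>l\<close> unless \<open>l j = 0\<close>, and in that case the coefficient is
      zero.\<close>
    have "of_nat (l j) = (0::'a) \<or> (l(j := l j - 1))(j := (l(j := l j - 1)) j + 1) = l"
      by (cases "l j") (auto simp: fun_eq_iff)
    moreover have "?l(j := ?l j - 1) = l"
      by (simp add: fun_eq_iff)
    ultimately show ?thesis
      using True i kidx_sign[OF fin, of j, where ?'k = 'a]
      by (auto simp: fgen0_mul fgen1_mul scl_scl algebra_simps simp flip: scl_add_left)
  next
    case False
    then have "?l(i := ?l i - 1) = (l(i := l i - 1))(j := (l(i := l i - 1)) j + 1)"
      by (auto simp: fun_eq_iff)
    with False show ?thesis
      by (simp add: fgen0_mul)
  qed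
  \<comment> \<open>If \<open>j\<close> lies in \<open>J\<close>, the sum has no summand for
    \<open>j\<close>, and the extra term is zero as well since \<open>f_{j,1}\<close> squares to
    zero.\<close>
  have "(\<Sum>i\<in>{1..s} - J. if i = j then ?e else 0) = ?e"
    using assms(1) by (auto simp: fgen1_mul_0)
  moreover have "?l(i := ?l i + 1) = (l(i := l i + 1))(j := (l(i := l i + 1)) j + 1)" for i
    by (auto simp: fun_eq_iff)
  ultimately show ?thesis
    by (simp only: odd_der_def prod.case mul0 fgen0_mul sum.distrib 1 cong: sum.cong)
       (simp add: algebra_simps)
qed

text \<open>The Leibniz rule for an odd left factor, in the only case used: no even factors, and
  \<open>i\<close> below all of \<open>J\<close>. Then \<open>i\<close> has all of \<open>J\<close>
  to its right, while the counts for the elements of \<open>J\<close> do not change.\<close>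

lemma odd_der_fgen1_mul:
  fixes c :: "nat \<Rightarrow> 'k::field"
  assumes "finite J" "\<And>j. j \<in> J \<Longrightarrow> i < j"
  shows "odd_der s c (\<lambda>_. 0, insert i J) =
     scl ((-1) ^ card J) (amul (FV s) (fgen0 i) (bvec (\<lambda>_. 0, J))) +
     amul (FV s) (fgen1 i) (odd_der s c (\<lambda>_. 0, J))"
proof -
  have i: "i \<notin> J"
    using assms(2) by blast
  have ki: "kidx i (insert i J) = card J"
    unfolding kidx_def using assms(2) by (auto intro: arg_cong[where f = card])
  have kj: "kidx j (insert i J) = kidx j J" if "j \<in> J" for j
    unfolding kidx_def using assms(2)[OF that] by (auto intro: arg_cong[where f = card])
  have mul: "amul (FV s) (fgen1 i) (bvec (l, J - {j}) :: mono_idx \<Rightarrow>\<^sub>0 'k) = bvec (l, insert i J - {j})" if "j \<in> J" for j l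
  proof -
    have "insert i J - {j} = insert i (J - {j})"
      using that i by auto
    moreover have "i < k" if "k \<in> J - {j}" for k
      using assms(2) that by blast
    ultimately show ?thesis
      using fgen1_mul_less[of "J - {j}" i s l] by metis
  qed
  have "odd_der s c (\<lambda>_. 0, insert i J) =
      scl ((-1) ^ card J) (bvec ((\<lambda>_. 0)(i := 1), J)) +
      (\<Sum>j\<in>J. scl ((-1) ^ kidx j J) (bvec ((\<lambda>_. 0)(j := 1), insert i J - {j})))"
    using assms(1) i by (simp add: odd_der_def ki kj insert_Diff_if)
  also have "(\<Sum>j\<in>J. scl ((-1) ^ kidx j J) (bvec ((\<lambda>_. 0)(j := 1), insert i J - {j}))) =
      amul (FV s) (fgen1 i) (odd_der s c (\<lambda>_. 0, J))"
    using mul unfolding fgen1_def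
    by (simp add: odd_der_def amul_bvec_scl amul_bvec_sum)
  finally show ?thesis
    by (simp only: fgen0_mul add_0_left)
qed

section \<open>The coaction on monomials\<close>

text \<open>Only the action on generators matters from here on, so \<open>V\<close> and its dual are
  left out. The scalar \<open>c j\<close> stands for \<open>x(h_j)\<close>, and
  \<open>g^2 = 1\<close> is asked for only where such a scalar is nonzero.\<close>

locale FV_coaction = comm_group X for X :: "('x, 'm) monoid_scheme" (structure) +
  fixes g :: 'x and c :: "nat \<Rightarrow> 'k::field" and s :: nat and h :: "nat \<Rightarrow> 'x"
    and \<tau> :: "(mono_idx \<Rightarrow>\<^sub>0 'k) \<Rightarrow> (mono_idx \<times> ('x \<times> bool) \<Rightarrow>\<^sub>0 'k)"
  assumes g: "g \<in> carrier X"
    and h: "j \<in> {1..s} \<Longrightarrow> h j \<in> carrier X"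
    and gg: "j \<in> {1..s} \<Longrightarrow> c j \<noteq> 0 \<Longrightarrow> g \<otimes> g = \<one>"
    and hom: "superalgebra_hom (FV s) (tensor_algebra (FV s) (D_alg X)) \<tau>"
    and \<tau>_fgen0: "j \<in> {1..s} \<Longrightarrow> \<tau> (fgen0 j) =
      tens (fgen0 j) (bvec (h j, False)) + scl (c j) (tens (fgen1 j) (bvec (h j \<otimes> g, True)))"
    and \<tau>_fgen1: "j \<in> {1..s} \<Longrightarrow> \<tau> (fgen1 j) =
      tens (fgen0 j) (bvec (h j, True)) + tens (fgen1 j) (bvec (h j \<otimes> g, False))"
begin

section \<open>Weights of monomials\<close>

definition weight :: "mono_idx \<Rightarrow> 'x" where
  "weight = (\<lambda>(l, J). (\<Otimes>j\<in>{1..s}. h j [^] l j) \<otimes> (\<Otimes>j\<in>J. h j) \<otimes> g [^] card J)"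

lemma weight_closed: "J \<subseteq> {1..s} \<Longrightarrow> weight (l, J) \<in> carrier X"
  unfolding weight_def prod.case using g h
  by (intro m_closed finprod_closed nat_pow_closed) auto

lemma weight_fgen0_mul:
  assumes "j \<in> {1..s}" "J \<subseteq> {1..s}"
  shows "weight (l(j := l j + 1), J) = h j \<otimes> weight (l, J)"
proof -
  have P: "(\<Otimes>i\<in>{1..s}. h i [^] l i) \<in> carrier X" "(\<Otimes>i\<in>J. h i) \<in> carrier X"
    using h assms(2) by (auto intro!: finprod_closed)
  \<comment> \<open>The additional factor \<open>h j\<close> is written as a family equal to one
    away from \<open>j\<close>, so that the product splits pointwise.\<close>
  have "(\<Otimes>i\<in>{1..s}. h i [^] (l(j := l j + 1)) i) =
      (\<Otimes>i\<in>{1..s}. (if j = i then h i else \<one>) \<otimes> h i [^] l i)"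
    using h by (intro finprod_cong') (auto simp: m_comm)
  also have "\<dots> = (\<Otimes>i\<in>{1..s}. if j = i then h i else \<one>) \<otimes> (\<Otimes>i\<in>{1..s}. h i [^] l i)"
    using h by (intro finprod_multf) auto
  also have "(\<Otimes>i\<in>{1..s}. if j = i then h i else \<one>) = h j"
    using h assms(1) by (intro finprod_singleton) auto
  finally show ?thesis
    using P g h[OF assms(1)] by (simp add: weight_def m_assoc)
qed

lemma weight_fgen1_mul:
  assumes "j \<in> {1..s}" "J \<subseteq> {1..s}" "j \<notin> J"
  shows "weight (l, insert j J) = h j \<otimes> g \<otimes> weight (l, J)"
proof -
  have fin: "finite J"
    using assms(2) finite_subset by blast
  have P: "(\<Otimes>i\<in>{1..s}. h i [^] l i) \<in> carrier X" "(\<Otimes>i\<in>J. h i) \<in> carrier X"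
    using h assms(2) by (auto intro!: finprod_closed)
  have "(\<Otimes>i\<in>insert j J. h i) = h j \<otimes> (\<Otimes>i\<in>J. h i)"
    using h assms fin by (intro finprod_insert) auto
  then show ?thesis
    using P g h[OF assms(1)] fin assms(3) by (simp add: weight_def m_ac)
qed

lemma weight_one: "weight (\<lambda>_. 0, {}) = \<one>"
  using h by (simp add: weight_def)

section \<open>The coaction on monomials by multiplicativity\<close>

lemma \<tau>_amul: "u \<in> vecs (FV s :: (mono_idx, 'k) superalgebra) \<Longrightarrow> v \<in> vecs (FV s :: (mono_idx, 'k) superalgebra) \<Longrightarrow>
    \<tau> (amul (FV s) u v) = amul (tensor_algebra (FV s) (D_alg X)) (\<tau> u) (\<tau> v)"
  using hom by (simp add: superalgebra_hom_def)

lemma bvec_mem: "(l, J) \<in> mono_idxs s \<Longrightarrow> bvec (l, J) \<in> vecs (FV s)"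
  by (simp add: vecs_bvec FV_def)

lemma fgen_mem:
  assumes "j \<in> {1..s}"
  shows "fgen0 j \<in> vecs (FV s)" "fgen1 j \<in> vecs (FV s)"
  unfolding fgen0_def fgen1_def using assms by (auto intro!: bvec_mem simp: mono_idxs_def)

text \<open>The claimed value of the coaction. The shift by \<open>inv g\<close> fits
  \<open>f_{j,1}\<close>, whose weight is \<open>h_j g\<close> while its odd component carries
  \<open>h_j z\<close>.\<close>

definition \<tau>_mono :: "mono_idx \<Rightarrow> (mono_idx \<times> ('x \<times> bool) \<Rightarrow>\<^sub>0 'k)" where
  "\<tau>_mono m = tens (bvec m) (bvec (weight m, False)) +
     tens (odd_der s c m) (bvec (inv g \<otimes> weight m, True))"

text \<open>Of the four products of components the one with two factors \<open>z\<close> vanishes.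
  The even one gives the new weight, and the other two add up to the Leibniz rule
  \<open>odd_der_fgen0_mul\<close> once their characters agree.\<close>

lemma \<tau>_mono_fgen0:
  assumes j: "j \<in> {1..s}" and J: "J \<subseteq> {1..s}"
  shows "amul (tensor_algebra (FV s) (D_alg X)) (\<tau> (fgen0 j)) (\<tau>_mono (l, J)) = \<tau>_mono (l(j := l j + 1), J)"
proof -
  let ?A = "tensor_algebra (FV s) (D_alg X)" and ?w = "weight (l, J)"
  let ?f0 = "fgen0 j :: mono_idx \<Rightarrow>\<^sub>0 'k" and ?f1 = "fgen1 j :: mono_idx \<Rightarrow>\<^sub>0 'k"
  note [simp] = weight_closed[OF J] g h[OF j]
  have e0: "amul ?A (tens ?f0 (bvec (u, False))) (tens v (bvec (u', i))) =
      tens (amul (FV s) ?f0 v) (bvec (u \<otimes> u', i))" for u v u' i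
    by (simp add: fgen0_def tensor_mul_even)
  \<comment> \<open>Here \<open>z\<close> passes the monomial, which has parity
    \<open>card J\<close>; this is the sign in the Leibniz rule.\<close>
  have o1: "amul ?A (tens ?f1 (bvec (u, True))) (tens (bvec (l, J)) (bvec (u', False))) =
      scl ((-1) ^ card J) (tens (amul (FV s) ?f1 (bvec (l, J))) (bvec (u \<otimes> u', True)))" for u u'
    by (auto simp add: fgen1_def tensor_mul_odd_even FV_def)
  have oo: "amul ?A (tens ?f1 (bvec (u, True))) (tens v (bvec (u', True))) = 0" for u v u'
    by (simp add: fgen1_def tensor_mul_odd_odd)
  have add: "amul ?A (tens ?f0 (bvec b)) (y + y') = amul ?A (tens ?f0 (bvec b)) y + amul ?A (tens ?f0 (bvec b)) y'"
    "amul ?A (tens ?f1 (bvec b)) (y + y') = amul ?A (tens ?f1 (bvec b)) y + amul ?A (tens ?f1 (bvec b)) y'" for b y y'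
    by (simp_all add: fgen0_def fgen1_def amul_bvec_add)
  have w: "weight (l(j := l j + 1), J) = h j \<otimes> ?w"
    by (rule weight_fgen0_mul[OF j J])
  have w': "h j \<otimes> (inv g \<otimes> ?w) = inv g \<otimes> (h j \<otimes> ?w)"
    by (simp add: m_lcomm)
  \<comment> \<open>The two odd terms carry \<open>g\<close> and \<open>inv g\<close> respectively,
    which \<open>g^2 = 1\<close> identifies. If \<open>c j = 0\<close>, the term with
    \<open>g\<close> is absent.\<close>
  have gw: "h j \<otimes> g \<otimes> ?w = inv g \<otimes> (h j \<otimes> ?w)" if "c j \<noteq> 0"
  proof -
    have "inv g = g"
      using gg[OF j that] by (simp add: inv_equality)
    then show ?thesis
      by (simp add: m_ac)
  qed
  have "amul ?A (\<tau> ?f0) (\<tau>_mono (l, J)) =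
      tens (amul (FV s) ?f0 (bvec (l, J))) (bvec (h j \<otimes> ?w, False)) +
      tens (amul (FV s) ?f0 (odd_der s c (l, J))) (bvec (inv g \<otimes> (h j \<otimes> ?w), True)) +
      scl (c j * (-1) ^ card J) (tens (amul (FV s) ?f1 (bvec (l, J))) (bvec (h j \<otimes> g \<otimes> ?w, True)))"
    by (simp only: \<tau>_fgen0[OF j] \<tau>_mono_def amul_add_left amul_scl_left add e0 o1 oo w' scl_scl add.assoc add_0_right)
  also have "\<dots> = \<tau>_mono (l(j := l j + 1), J)"
    unfolding \<tau>_mono_def w odd_der_fgen0_mul[OF j J] fgen0_mul tens_add_left tens_scl_left
    by (cases "c j = 0") (simp_all add: gw mult.commute add.assoc del: tens_bvec)
  finally show ?thesis .
qed

text \<open>Again three products survive, now combined by \<open>odd_der_fgen1_mul\<close>. The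
  characters of the two odd terms agree in any abelian group, since \<open>g\<close> meets
  \<open>inv g\<close> in both computations.\<close>

lemma \<tau>_mono_fgen1:
  assumes j: "j \<in> {1..s}" and J: "J \<subseteq> {1..s}" and less: "\<And>i. i \<in> J \<Longrightarrow> j < i"
  shows "amul (tensor_algebra (FV s) (D_alg X)) (\<tau> (fgen1 j)) (\<tau>_mono (\<lambda>_. 0, J)) = \<tau>_mono (\<lambda>_. 0, insert j J)"
proof -
  let ?l = "\<lambda>_. 0 :: nat"
  let ?A = "tensor_algebra (FV s) (D_alg X)" and ?w = "weight (?l, J)"
  let ?f0 = "fgen0 j :: mono_idx \<Rightarrow>\<^sub>0 'k" and ?f1 = "fgen1 j :: mono_idx \<Rightarrow>\<^sub>0 'k"
  note [simp] = weight_closed[OF J] g h[OF j]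
  have fin: "finite J"
    using J finite_subset by blast
  have jJ: "j \<notin> J"
    using less by blast
  have e1: "amul ?A (tens ?f1 (bvec (u, False))) (tens v (bvec (u', i))) =
      tens (amul (FV s) ?f1 v) (bvec (u \<otimes> u', i))" for u v u' i
    by (simp add: fgen1_def tensor_mul_even)
  have o0: "amul ?A (tens ?f0 (bvec (u, True))) (tens (bvec (?l, J)) (bvec (u', False))) =
      scl ((-1) ^ card J) (tens (amul (FV s) ?f0 (bvec (?l, J))) (bvec (u \<otimes> u', True)))" for u u'
    by (auto simp add: fgen0_def tensor_mul_odd_even FV_def)
  have oo: "amul ?A (tens ?f0 (bvec (u, True))) (tens v (bvec (u', True))) = 0" for u v u'
    by (simp add: fgen0_def tensor_mul_odd_odd)
  have add: "amul ?A (tens ?f0 (bvec b)) (y + y') = amul ?A (tens ?f0 (bvec b)) y + amul ?A (tens ?f0 (bvec b)) y'"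
    "amul ?A (tens ?f1 (bvec b)) (y + y') = amul ?A (tens ?f1 (bvec b)) y + amul ?A (tens ?f1 (bvec b)) y'" for b y y'
    by (simp_all add: fgen0_def fgen1_def amul_bvec_add)
  have w: "weight (?l, insert j J) = h j \<otimes> g \<otimes> ?w"
    by (rule weight_fgen1_mul[OF j J jJ])
  have cancel: "g \<otimes> (inv g \<otimes> y) = y" "inv g \<otimes> (g \<otimes> y) = y" if "y \<in> carrier X" for y
    using that by (simp_all flip: m_assoc)
  have w1: "h j \<otimes> g \<otimes> (inv g \<otimes> ?w) = h j \<otimes> ?w"
    by (simp add: m_assoc cancel)
  have w2: "inv g \<otimes> (h j \<otimes> g \<otimes> ?w) = h j \<otimes> ?w"
    by (simp add: m_lcomm[of "h j" g] m_assoc cancel)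
  have mul1: "amul (FV s) ?f1 (bvec (?l, J)) = bvec (?l, insert j J)"
    by (rule fgen1_mul_less[OF less])
  have "amul ?A (\<tau> ?f1) (\<tau>_mono (?l, J)) =
      scl ((-1) ^ card J) (tens (amul (FV s) ?f0 (bvec (?l, J))) (bvec (h j \<otimes> ?w, True))) +
      (tens (amul (FV s) ?f1 (bvec (?l, J))) (bvec (h j \<otimes> g \<otimes> ?w, False)) +
       tens (amul (FV s) ?f1 (odd_der s c (?l, J))) (bvec (h j \<otimes> ?w, True)))"
    by (simp only: \<tau>_fgen1[OF j] \<tau>_mono_def amul_add_left add e1 o0 oo w1 add_0_right)
  also have "\<dots> = \<tau>_mono (?l, insert j J)"
    by (simp add: \<tau>_mono_def w w2 odd_der_fgen1_mul[OF fin less] mul1 tens_add_left tens_scl_left add.left_commute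
        del: tens_bvec)
  finally show ?thesis .
qed

text \<open>The induction adjoins a new smallest index, so that the product with the new generator
  on the left is already sorted and carries no sign.\<close>

lemma \<tau>_bvec_odd:
  assumes "J \<subseteq> {1..s}"
  shows "\<tau> (bvec (\<lambda>_. 0, J)) = \<tau>_mono (\<lambda>_. 0, J)"
proof -
  have "finite J"
    using assms finite_subset by blast
  then show ?thesis
    using assms
  proof (induction J rule: finite_linorder_min_induct)
    case empty
    have "\<tau> (bvec (\<lambda>_. 0, {})) = tens (bvec (\<lambda>_. 0, {})) (bvec (\<one>, False))"
      using hom by (simp add: superalgebra_hom_def FV_def D_alg_def tensor_algebra_def)
    moreover have "odd_der s c (\<lambda>_. 0, {}) = 0"
      by (simp add: odd_der_def)
    ultimately show ?case
      by (simp add: \<tau>_mono_def weight_one)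
  next
    case (insert j J)
    have "bvec (\<lambda>_. 0, insert j J) = amul (FV s) (fgen1 j) (bvec (\<lambda>_. 0, J) :: mono_idx \<Rightarrow>\<^sub>0 'k)"
      using insert.hyps by (simp add: fgen1_mul_less)
    moreover have "(\<lambda>_. 0, J) \<in> mono_idxs s"
      using insert.prems by (auto simp: mono_idxs_def)
    ultimately show ?case
      using insert by (simp add: \<tau>_amul fgen_mem bvec_mem \<tau>_mono_fgen1)
  qed
qed

text \<open>Induction on the total degree in the even generators, starting from the purely odd
  monomials. An even generator can be split off on the left without a sign, whatever its
  index.\<close>

lemma \<tau>_bvec:
  assumes "(l, J) \<in> mono_idxs s"
  shows "\<tau> (bvec (l, J)) = \<tau>_mono (l, J)"
  using assms
proof (induction "\<Sum>j\<in>{1..s}. l j" arbitrary: l)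
  case 0
  then have "l = (\<lambda>_. 0)"
    by (auto simp: mono_idxs_def fun_eq_iff)
  with 0 show ?case
    by (simp add: \<tau>_bvec_odd mono_idxs_def)
next
  case (Suc n)
  obtain j where j: "j \<in> {1..s}" "l j \<noteq> 0"
    using Suc.hyps(2) by (metis sum.neutral Zero_not_Suc)
  define l' where "l' = l(j := l j - 1)"
  have l: "l = l'(j := l' j + 1)"
    using j(2) by (auto simp: l'_def)
  have l': "(l', J) \<in> mono_idxs s"
    using Suc.prems by (auto simp: l'_def mono_idxs_def)
  have "(\<Sum>i\<in>{1..s} - {j}. l' i) = (\<Sum>i\<in>{1..s} - {j}. l i)"
    by (simp add: l'_def)
  then have "(\<Sum>i\<in>{1..s}. l i) = (\<Sum>i\<in>{1..s}. l' i) + 1"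
    using j sum.remove[of "{1..s}" j l] sum.remove[of "{1..s}" j l'] by (simp add: l'_def)
  then have "\<tau> (bvec (l', J)) = \<tau>_mono (l', J)"
    using Suc.hyps l' by simp
  moreover have "bvec (l, J) = amul (FV s) (fgen0 j) (bvec (l', J) :: mono_idx \<Rightarrow>\<^sub>0 'k)"
    by (simp only: fgen0_mul flip: l)
  moreover have "J \<subseteq> {1..s}"
    using Suc.prems by (simp add: mono_idxs_def)
  ultimately show ?case
    using j(1) l' by (simp only: \<tau>_amul fgen_mem bvec_mem \<tau>_mono_fgen0 flip: l)
qed

text \<open>The even components force all weights to be one. Only then do all odd components share a
  single character, so that their vanishing becomes one equation in \<open>F[V]\<close>.\<close>

lemma invariant_iff:
  assumes fin: "finite M" and M: "M \<subseteq> mono_idxs s" and a: "\<And>m. m \<in> M \<Longrightarrow> a m \<noteq> 0"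
  shows "(\<Sum>m\<in>M. scl (a m) (bvec m)) \<in> invariants X s \<tau> \<longleftrightarrow>
    (\<forall>m\<in>M. weight m = \<one>) \<and> (\<Sum>m\<in>M. scl (a m) (odd_der s c m)) = 0"
proof -
  let ?f = "\<Sum>m\<in>M. scl (a m) (bvec m)"
  let ?d = "\<Sum>m\<in>M. scl (a m) (odd_der s c m)"
  have mem: "bvec m \<in> vecs (FV s :: (mono_idx, 'k) superalgebra)" if "m \<in> M" for m
    using M that by (cases m) (auto intro: bvec_mem)
  have "linear_between (FV s :: (mono_idx, 'k) superalgebra)
      (tensor_algebra (FV s) (D_alg X) :: (mono_idx \<times> ('x \<times> bool), 'k) superalgebra) \<tau>"
    using hom by (simp add: superalgebra_hom_def even_linear_def)
  then have "\<tau> ?f = (\<Sum>m\<in>M. scl (a m) (\<tau> (bvec m)))"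
    using mem by (rule linear_between_sum)
  also have "\<dots> = (\<Sum>m\<in>M. scl (a m) (\<tau>_mono m))"
    using M \<tau>_bvec by (intro sum.cong) auto
  finally have \<tau>f: "\<tau> ?f = (\<Sum>m\<in>M. scl (a m) (\<tau>_mono m))" .
  have f: "?f \<in> vecs (FV s :: (mono_idx, 'k) superalgebra)"
    by (intro vecs_sum vecs_scl mem)
  have inv: "?f \<in> invariants X s \<tau> \<longleftrightarrow> \<tau> ?f = tens ?f (bvec (\<one>, False))"
    using f by (simp add: invariants_def D_alg_def)
  \<comment> \<open>With trivial weights every odd component carries the same basis vector
    \<open>(inv g, True)\<close>, which can be factored out.\<close>
  have *: "\<tau> ?f = tens ?f (bvec (\<one>, False)) + tens ?d (bvec (inv g, True))" if "\<forall>m\<in>M. weight m = \<one>"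
    using that g by (simp add: \<tau>f \<tau>_mono_def scl_add_right sum.distrib tens_sum_left tens_scl_left)
  have wt: "weight m = \<one>" if "\<tau> ?f = tens ?f (bvec (\<one>, False))" "m \<in> M" for m
  proof (rule ccontr)
    assume "weight m \<noteq> \<one>"
    \<comment> \<open>The coefficient at \<open>m\<close> tensor its own weight is read off twice:
      it is zero in \<open>f\<close> tensor one, and it is \<open>a m\<close> in the coaction, where
      odd components and other monomials do not contribute.\<close>
    then have "0 = Poly_Mapping.lookup (\<tau> ?f) (m, (weight m, False))"
      by (simp only: that(1) lookup_tens_bvec) simp
    also have "\<dots> = (\<Sum>m'\<in>M. if m' = m then a m' else 0)"
      unfolding \<tau>f lookup_sum \<tau>_mono_def
      by (intro sum.cong) (auto simp: lookup_add lookup_tens_bvec lookup_single when_def simp del: tens_bvec)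
    also have "\<dots> = a m"
      using fin that(2) by simp
    finally show False
      using a[OF that(2)] by simp
  qed
  \<comment> \<open>Tensoring with a basis vector is injective, because the coefficients at that
    vector recover the first factor.\<close>
  have "tens ?d (bvec (inv g, True)) = 0 \<longleftrightarrow> ?d = 0"
  proof
    assume "tens ?d (bvec (inv g, True)) = 0"
    then have "Poly_Mapping.lookup (tens ?d (bvec (inv g, True))) (b, (inv g, True)) = 0" for b
      by simp
    then show "?d = 0"
      by (intro poly_mapping_eqI) (simp only: lookup_tens_bvec if_True lookup_zero simp_thms)
  qed simp
  then have "\<tau> ?f = tens ?f (bvec (\<one>, False)) \<longleftrightarrow> ?d = 0" if "\<forall>m\<in>M. weight m = \<one>"
    unfolding *[OF that] by (simp only: add_cancel_left_right)
  with wt show ?thesis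
    unfolding inv by blast
qed

end

section \<open>Invariance criterion: from the dual supermodule to the generators\<close>

theorem proposition6p2:
  fixes X :: "('x, 'm) monoid_scheme"
    and g :: 'x
    and x :: "('x \<Rightarrow>\<^sub>0 'k::field) \<Rightarrow> 'k"
    and s :: nat
    and h :: "nat \<Rightarrow> 'x"
    and V :: "('b, 'x \<times> bool, 'k) supercomodule"
    and \<phi> :: "('b \<Rightarrow>\<^sub>0 'k) \<Rightarrow> (nat \<times> ('x \<times> bool) \<Rightarrow>\<^sub>0 'k)"
    and \<tau> :: "(mono_idx \<Rightarrow>\<^sub>0 'k) \<Rightarrow> (mono_idx \<times> ('x \<times> bool) \<Rightarrow>\<^sub>0 'k)"
    and a :: "(nat \<Rightarrow> nat) \<Rightarrow> nat set \<Rightarrow> 'k"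
  assumes "CHAR('k) \<noteq> 2"
    and "diagonalizable_char_group X"
    and "g \<in> carrier X"
    and "x \<in> Lie X"
    and "(\<exists>u\<in>FX X. x u \<noteq> 0) \<longrightarrow> g \<otimes>\<^bsub>X\<^esub> g = \<one>\<^bsub>X\<^esub>"
    and "\<forall>j\<in>{1..s}. h j \<in> carrier X"
    and "D_supermodule X g x V"
    and "finite (Idx V)"
    and "supercomodule_iso (dual (D_antipode X g) V) (L_sum X g x s h) \<phi>"
    and "is_coaction X s (dual (D_antipode X g) V) \<phi> \<tau>"
    and "finite {(l, J) \<in> mono_idxs s. a l J \<noteq> 0}"
  shows "(\<Sum>(l, J) \<in> {(l, J) \<in> mono_idxs s. a l J \<noteq> 0}. scl (a l J) (fmono s l J)) \<in> invariants X s \<tau>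
    \<longleftrightarrow>
    (\<forall>(l, J) \<in> mono_idxs s. a l J \<noteq> 0 \<longrightarrow>
       (\<Otimes>\<^bsub>X\<^esub>j\<in>{1..s}. h j [^]\<^bsub>X\<^esub> l j) \<otimes>\<^bsub>X\<^esub> (\<Otimes>\<^bsub>X\<^esub>j\<in>J. h j) \<otimes>\<^bsub>X\<^esub> g [^]\<^bsub>X\<^esub> card J = \<one>\<^bsub>X\<^esub>) \<and>
    (\<Sum>(l, J) \<in> {(l, J) \<in> mono_idxs s. a l J \<noteq> 0}. scl (a l J)
       ((\<Sum>j \<in> {1..s} - J. scl ((-1) ^ kidx j (J \<union> {j}) * of_nat (l j) * x (bvec (h j)))
            (fmono s (l(j := l j - 1)) (J \<union> {j}))) +
        (\<Sum>j \<in> J. scl ((-1) ^ kidx j J) (fmono s (l(j := l j + 1)) (J - {j}))))) = 0"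
proof -
  let ?W = "dual (D_antipode X g) V" and ?L = "L_sum X g x s h"
  let ?M = "{(l, J) \<in> mono_idxs s. a l J \<noteq> 0}"
  let ?c = "\<lambda>j. x (bvec (h j))"
  have X: "comm_group X"
    using assms(2) by (simp add: diagonalizable_char_group_def)
  have hom: "superalgebra_hom (FV s) (tensor_algebra (FV s) (D_alg X)) \<tau>"
    using assms(10) by (simp add: is_coaction_def)
  have \<tau>_gens: "\<tau> (gens v) = tens_map gens (\<lambda>u. u) (Coact ?L v)" if "v \<in> vecs ?L" for v
  proof -
    \<comment> \<open>Surjectivity of \<open>\<phi>\<close> turns the condition on
      \<open>\<tau>\<close> over the dual of \<open>V\<close> into one over the sum of the
      \<open>L(h_j)\<close>; compatibility of \<open>\<phi>\<close> with the coactions then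
      eliminates \<open>\<phi>\<close>.\<close>
    have "v \<in> \<phi> ` vecs ?W"
      using assms(9) that by (simp add: supercomodule_iso_def bij_betw_def)
    then obtain w where w: "w \<in> vecs ?W" "v = \<phi> w"
      by blast
    have "\<tau> (gens v) = tens_map (gens \<circ> \<phi>) (\<lambda>u. u) (Coact ?W w)"
      using assms(10) w by (simp add: is_coaction_def)
    also have "\<dots> = tens_map gens (\<lambda>u. u) (tens_map \<phi> (\<lambda>u. u) (Coact ?W w))"
      by (simp add: gens_def tens_map_tens_map_id)
    also have "\<dots> = tens_map gens (\<lambda>u. u) (Coact ?L v)"
      using assms(9) w by (simp add: supercomodule_iso_def)
    finally show ?thesis .
  qed
  have mem: "bvec (j, (h j, i)) \<in> vecs ?L" if "j \<in> {1..s}" for j i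
    using that by (simp add: vecs_bvec L_sum_def direct_sum_def L_def)
  interpret FV_coaction X g ?c s h \<tau>
  proof (rule FV_coaction.intro[OF X FV_coaction_axioms.intro])
    show "g \<in> carrier X"
      by (rule assms(3))
    show "superalgebra_hom (FV s) (tensor_algebra (FV s) (D_alg X)) \<tau>"
      by (rule hom)
  next
    fix j assume j: "j \<in> {1..s}"
    show hj: "h j \<in> carrier X"
      using assms(6) j by blast
    show "g \<otimes>\<^bsub>X\<^esub> g = \<one>\<^bsub>X\<^esub>" if "?c j \<noteq> 0"
    proof -
      \<comment> \<open>The character \<open>h j\<close> itself is the vector of \<open>FX\<close>
        witnessing that \<open>x\<close> is nonzero.\<close>
      have "bvec (h j) \<in> FX X"
        using hj by (simp add: FX_def)
      with assms(5) that show ?thesis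
        by blast
    qed
    show "\<tau> (fgen0 j) = tens (fgen0 j) (bvec (h j, False)) +
        scl (?c j) (tens (fgen1 j) (bvec (h j \<otimes>\<^bsub>X\<^esub> g, True)))"
      using \<tau>_gens[OF mem[OF j, of False]] by (simp only: coact_fgen0) (simp add: gens_def)
    show "\<tau> (fgen1 j) = tens (fgen0 j) (bvec (h j, True)) + tens (fgen1 j) (bvec (h j \<otimes>\<^bsub>X\<^esub> g, False))"
      using \<tau>_gens[OF mem[OF j, of True]] coact_fgen1[of X g h j x s, OF X assms(3) hj]
      by (simp add: gens_def)
  qed
  have "(\<Sum>(l, J)\<in>?M. scl (a l J) (fmono s l J)) = (\<Sum>m\<in>?M. scl (case_prod a m) (bvec m))"
    by (intro sum.cong) (auto simp: fmono_eq)
  moreover have "(\<Sum>(l, J)\<in>?M. scl (a l J)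
       ((\<Sum>j \<in> {1..s} - J. scl ((-1) ^ kidx j (J \<union> {j}) * of_nat (l j) * ?c j)
            (fmono s (l(j := l j - 1)) (J \<union> {j}))) +
        (\<Sum>j \<in> J. scl ((-1) ^ kidx j J) (fmono s (l(j := l j + 1)) (J - {j}))))) =
      (\<Sum>m\<in>?M. scl (case_prod a m) (odd_der s ?c m))"
  proof (rule sum.cong[OF refl])
    fix m assume m: "m \<in> ?M"
    obtain l J where lJ: "m = (l, J)"
      by (cases m)
    \<comment> \<open>The changed exponents and subsets are still admissible indices, so all
      products of generators in condition (2) are basis vectors.\<close>
    have "fmono s (l(j := l j - 1)) (J \<union> {j}) = (bvec (l(j := l j - 1), J \<union> {j}) :: mono_idx \<Rightarrow>\<^sub>0 'k)"
      if "j \<in> {1..s} - J" for j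
      using that m lJ by (intro fmono_eq) (auto simp: mono_idxs_def)
    moreover have "fmono s (l(j := l j + 1)) (J - {j}) = (bvec (l(j := l j + 1), J - {j}) :: mono_idx \<Rightarrow>\<^sub>0 'k)"
      if "j \<in> J" for j
      using that m lJ by (intro fmono_eq) (auto simp: mono_idxs_def)
    ultimately show "(case m of (l, J) \<Rightarrow> scl (a l J)
       ((\<Sum>j \<in> {1..s} - J. scl ((-1) ^ kidx j (J \<union> {j}) * of_nat (l j) * ?c j)
            (fmono s (l(j := l j - 1)) (J \<union> {j}))) +
        (\<Sum>j \<in> J. scl ((-1) ^ kidx j J) (fmono s (l(j := l j + 1)) (J - {j}))))) =
      scl (case_prod a m) (odd_der s ?c m)"
      by (simp only: lJ odd_der_def prod.case cong: sum.cong)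
  qed
  moreover have "(\<forall>m\<in>?M. weight m = \<one>\<^bsub>X\<^esub>) \<longleftrightarrow> (\<forall>(l, J) \<in> mono_idxs s. a l J \<noteq> 0 \<longrightarrow>
       (\<Otimes>\<^bsub>X\<^esub>j\<in>{1..s}. h j [^]\<^bsub>X\<^esub> l j) \<otimes>\<^bsub>X\<^esub> (\<Otimes>\<^bsub>X\<^esub>j\<in>J. h j) \<otimes>\<^bsub>X\<^esub> g [^]\<^bsub>X\<^esub> card J = \<one>\<^bsub>X\<^esub>)"
    by (auto simp: weight_def)
  moreover have "(\<Sum>m\<in>?M. scl (case_prod a m) (bvec m)) \<in> invariants X s \<tau> \<longleftrightarrow>
      (\<forall>m\<in>?M. weight m = \<one>\<^bsub>X\<^esub>) \<and> (\<Sum>m\<in>?M. scl (case_prod a m) (odd_der s ?c m)) = 0"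
    by (rule invariant_iff) (use assms(11) in auto)
  ultimately show ?thesis
    by (simp only:)
qed

end
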